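(* Let $k\ge 1$ and $n>10k^3$ be integers, and let $w_1,\dots,w_n$ be real numbers with $w_1+\cdots+w_n\ge 0$. Then there are at least $\binom{n-1}{k-1}$ subsets $A\subset\{1,\dots,n\}$ of size $k$ satisfying $\sum_{i\in A} w_i\ge 0$. *)

theory Defs
  imports Complex_Main
begin

end

(* Let x be an element of maximal weight c > 0. As long as some k-set containing x has negative
   sum, delete its other k - 1 elements: each deletion raises the total weight by more than c.

   If this can be done 2k times, the remaining m = n - 2k(k-1) elements have total weight at
   least 2kc, while each k-set has weight at most kc; averaging over all k-sets of the remaining
   elements shows that at least 2 C(m-1, k-1) of them are nonnegative.

   Otherwise (unless nothing was deleted, so that every k-set containing x is nonnegative) we are
   left with m elements of total weight at least c, among which every k-set containing x is
   nonnegative. This gives C(m-1, k-1) nonnegative sets through x. The remaining elements without x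
   still have nonnegative total weight, and the same procedure with only k deletions finds almost
   as many nonnegative sets avoiding x.

   In both cases the number of sets is at least 2 C(n-2-3k(k-1), k-1), which exceeds C(n-1, k-1)
   because n is large compared to k^3. *)
theory Submission
  imports Defs
begin

section \<open>Counting and averaging over k-subsets\<close>

definition nonneg_sets :: "('a \<Rightarrow> real) \<Rightarrow> nat \<Rightarrow> 'a set \<Rightarrow> 'a set set" where
  "nonneg_sets w k X = {A. A \<subseteq> X \<and> card A = k \<and> 0 \<le> sum w A}"

lemma finite_nonneg_sets: "finite X \<Longrightarrow> finite (nonneg_sets w k X)"
  unfolding nonneg_sets_def by (rule finite_subset[of _ "Pow X"]) auto

lemma nonneg_sets_mono: "X \<subseteq> Y \<Longrightarrow> nonneg_sets w k X \<subseteq> nonneg_sets w k Y"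
  unfolding nonneg_sets_def by auto

lemma card_subsets_containing:
  assumes "finite X" "x \<in> X" "k \<ge> 1"
  shows "card {A. A \<subseteq> X \<and> card A = k \<and> x \<in> A} = (card X - 1) choose (k - 1)"
proof -
  have "bij_betw (insert x) {B. B \<subseteq> X - {x} \<and> card B = k - 1}
          {A. A \<subseteq> X \<and> card A = k \<and> x \<in> A}"
  proof (rule bij_betw_byWitness[where f' = "\<lambda>A. A - {x}"])
    show "insert x ` {B. B \<subseteq> X - {x} \<and> card B = k - 1} \<subseteq> {A. A \<subseteq> X \<and> card A = k \<and> x \<in> A}"
    proof
      fix A assume "A \<in> insert x ` {B. B \<subseteq> X - {x} \<and> card B = k - 1}"
      then obtain B where B: "A = insert x B" "B \<subseteq> X - {x}" "card B = k - 1"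
        by auto
      have "finite B" "x \<notin> B"
        using B(2) assms(1) by (auto intro: finite_subset)
      then show "A \<in> {A. A \<subseteq> X \<and> card A = k \<and> x \<in> A}"
        using B assms by auto
    qed
  qed auto
  then have "card {A. A \<subseteq> X \<and> card A = k \<and> x \<in> A} = card {B. B \<subseteq> X - {x} \<and> card B = k - 1}"
    by (simp add: bij_betw_same_card)
  then show ?thesis
    using assms by (simp add: n_subsets)
qed

text \<open>Double counting: after exchanging the sums, each weight is counted once for every k-set
  that contains its element.\<close>

lemma sum_over_subsets:
  fixes w :: "'a \<Rightarrow> real"
  assumes "finite X" "k \<ge> 1"
  shows "(\<Sum>A | A \<subseteq> X \<and> card A = k. sum w A) = real ((card X - 1) choose (k - 1)) * sum w X"
proof -
  let ?S = "{A. A \<subseteq> X \<and> card A = k}"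
  have fin: "finite ?S"
    using assms(1) by simp
  have "(\<Sum>A\<in>?S. sum w A) = (\<Sum>A\<in>?S. \<Sum>i\<in>{i. i \<in> X \<and> i \<in> A}. w i)"
    by (intro sum.cong) auto
  also have "\<dots> = (\<Sum>i\<in>X. \<Sum>A\<in>{A. A \<in> ?S \<and> i \<in> A}. w i)"
    by (rule sum.swap_restrict[OF fin assms(1)])
  also have "\<dots> = (\<Sum>i\<in>X. real ((card X - 1) choose (k - 1)) * w i)"
  proof (rule sum.cong[OF refl])
    fix i assume "i \<in> X"
    have "{A. A \<in> ?S \<and> i \<in> A} = {A. A \<subseteq> X \<and> card A = k \<and> i \<in> A}"
      by auto
    then show "(\<Sum>A\<in>{A. A \<in> ?S \<and> i \<in> A}. w i) = real ((card X - 1) choose (k - 1)) * w i"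
      using card_subsets_containing[OF assms(1) \<open>i \<in> X\<close> assms(2)] by simp
  qed
  finally show ?thesis
    by (simp add: sum_distrib_left)
qed

text \<open>The sums over all k-sets add up to at least \<open>r * k * c\<close> times the binomial
  coefficient. Negative sets only lower this total, and each nonnegative set contributes at most
  \<open>k * c\<close>.\<close>

lemma card_nonneg_sets_average:
  fixes w :: "'a \<Rightarrow> real"
  assumes "finite X" "k \<ge> 1" "c > 0" "\<And>i. i \<in> X \<Longrightarrow> w i \<le> c" "real (r * k) * c \<le> sum w X"
  shows "r * ((card X - 1) choose (k - 1)) \<le> card (nonneg_sets w k X)"
proof -
  let ?C = "(card X - 1) choose (k - 1)" and ?N = "nonneg_sets w k X"
  let ?S = "{A. A \<subseteq> X \<and> card A = k}"
  have "real ?C * (real (r * k) * c) \<le> real ?C * sum w X"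
    using assms(5) by (intro mult_left_mono) auto
  also have "\<dots> = (\<Sum>A\<in>?S. sum w A)"
    using sum_over_subsets[OF assms(1,2)] by simp
  also have "\<dots> \<le> (\<Sum>A\<in>?N. sum w A)"
  proof -
    have "?N \<subseteq> ?S" "finite ?S"
      using assms(1) by (auto simp: nonneg_sets_def)
    then have "(\<Sum>A\<in>?S. sum w A) = (\<Sum>A\<in>?S - ?N. sum w A) + (\<Sum>A\<in>?N. sum w A)"
      by (rule sum.subset_diff)
    moreover have "(\<Sum>A\<in>?S - ?N. sum w A) \<le> 0"
      by (rule sum_nonpos) (auto simp: nonneg_sets_def)
    ultimately show ?thesis by simp
  qed
  also have "\<dots> \<le> real (card ?N) * (real k * c)"
  proof (rule sum_bounded_above)
    fix A assume A: "A \<in> ?N"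
    then have "sum w A \<le> real (card A) * c"
      using assms(4) by (intro sum_bounded_above) (auto simp: nonneg_sets_def)
    then show "sum w A \<le> real k * c"
      using A by (simp add: nonneg_sets_def)
  qed
  finally have "real (r * ?C) * (real k * c) \<le> real (card ?N) * (real k * c)"
    by (simp add: algebra_simps)
  moreover have "0 < real k * c"
    using assms(2,3) by simp
  ultimately have "real (r * ?C) \<le> real (card ?N)"
    by (meson mult_le_cancel_right_pos)
  then show ?thesis
    by (simp only: of_nat_le_iff)
qed

section \<open>Stars at a maximal element and the deletion process\<close>

definition star_nonneg :: "('a \<Rightarrow> real) \<Rightarrow> nat \<Rightarrow> 'a set \<Rightarrow> 'a \<Rightarrow> bool" where
  "star_nonneg w k X x \<longleftrightarrow> (\<forall>A. A \<subseteq> X \<and> card A = k \<and> x \<in> A \<longrightarrow> 0 \<le> sum w A)"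

text \<open>Counts only sets through \<open>x\<close>, so that sets avoiding \<open>x\<close> can
  later be added without overlap.\<close>

lemma card_nonneg_sets_through_star:
  assumes "star_nonneg w k X x" "finite X" "x \<in> X" "k \<ge> 1"
  shows "(card X - 1) choose (k - 1) \<le> card {A \<in> nonneg_sets w k X. x \<in> A}"
proof -
  have "{A \<in> nonneg_sets w k X. x \<in> A} = {A. A \<subseteq> X \<and> card A = k \<and> x \<in> A}"
    using assms(1) by (auto simp: nonneg_sets_def star_nonneg_def)
  then show ?thesis
    using card_subsets_containing[OF assms(2-4)] by simp
qed

lemma card_nonneg_sets_star:
  assumes "star_nonneg w k X x" "finite X" "x \<in> X" "k \<ge> 1"
  shows "(card X - 1) choose (k - 1) \<le> card (nonneg_sets w k X)"
proof -
  have "card {A \<in> nonneg_sets w k X. x \<in> A} \<le> card (nonneg_sets w k X)"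
    by (intro card_mono finite_nonneg_sets assms(2)) auto
  with card_nonneg_sets_through_star[OF assms] show ?thesis by linarith
qed

lemma finite_arg_max:
  fixes w :: "'a \<Rightarrow> real"
  assumes "finite X" "X \<noteq> {}"
  obtains x where "x \<in> X" "\<And>i. i \<in> X \<Longrightarrow> w i \<le> w x"
proof -
  have "Max (w ` X) \<in> w ` X"
    using assms by simp
  then obtain x where "x \<in> X" "w x = Max (w ` X)"
    by auto
  with assms(1) show thesis
    by (intro that) auto
qed

lemma max_nonneg:
  fixes w :: "'a \<Rightarrow> real"
  assumes "finite X" "x \<in> X" "\<And>i. i \<in> X \<Longrightarrow> w i \<le> w x" "0 \<le> sum w X"
  shows "0 \<le> w x"
proof (rule ccontr)
  assume "\<not> 0 \<le> w x"
  then have "sum w X < 0"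
    using sum_bounded_above[of X w "w x"] assms(1-3)
    by (smt (verit) card_gt_0_iff empty_iff mult_pos_neg of_nat_0_less_iff)
  with assms(4) show False by simp
qed

text \<open>With no positive weight, a nonnegative total forces all weights to vanish, so no set
  through \<open>x\<close> could be negative. Averaging needs this strict positivity to cancel
  \<open>w x\<close>.\<close>

lemma max_pos:
  fixes w :: "'a \<Rightarrow> real"
  assumes "finite X" "x \<in> X" "\<And>i. i \<in> X \<Longrightarrow> w i \<le> w x" "0 \<le> sum w X"
    and "\<not> star_nonneg w k X x"
  shows "0 < w x"
proof (rule ccontr)
  assume "\<not> 0 < w x"
  then have np: "w i \<le> 0" if "i \<in> X" for i
    using assms(3)[OF that] by simp
  then have "sum w X = 0"
    using assms(4) sum_nonpos[of X w] by force
  then have "w i = 0" if "i \<in> X" for i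
    using sum_nonneg_eq_0_iff[of X "\<lambda>i. - w i"] np that assms(1) by (simp add: sum_negf)
  then have "star_nonneg w k X x"
    unfolding star_nonneg_def by (metis order_refl subsetD sum.neutral)
  with assms(5) show False by simp
qed

text \<open>Induction on the number \<open>r\<close> of permitted deletions, stopping once the star
  at \<open>x\<close> is nonnegative. The clause \<open>Y = X \<or> w x \<le> sum w Y\<close>
  records that after any deletion even the removal of \<open>x\<close> leaves a nonnegative
  total.\<close>

lemma deletion_process:
  fixes w :: "'a \<Rightarrow> real"
  assumes "finite X" "x \<in> X" "\<And>i. i \<in> X \<Longrightarrow> w i \<le> w x" "0 \<le> sum w X"
  shows "\<exists>Y \<subseteq> X. x \<in> Y \<and> card X \<le> card Y + r * (k - 1) \<and> (Y = X \<or> w x \<le> sum w Y) \<and>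
           (real r * w x \<le> sum w Y \<or> star_nonneg w k Y x)"
proof (induction r)
  case 0
  then show ?case using assms by auto
next
  case (Suc r)
  have wx: "0 \<le> w x"
    using max_nonneg[OF assms] .
  from Suc obtain Y where Y: "Y \<subseteq> X" "x \<in> Y" "card X \<le> card Y + r * (k - 1)"
    "Y = X \<or> w x \<le> sum w Y" "real r * w x \<le> sum w Y \<or> star_nonneg w k Y x"
    by blast
  show ?case
  proof (cases "star_nonneg w k Y x")
    case True
    with Y show ?thesis by (intro exI[of _ Y]) auto
  next
    case False
    then obtain B where B: "B \<subseteq> Y" "card B = k" "x \<in> B" "sum w B < 0"
      by (meson not_le star_nonneg_def)
    have fin: "finite Y" "finite B"
      using Y(1) B(1) assms(1) by (meson finite_subset)+
    let ?D = "B - {x}"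
    have "card ?D = k - 1"
      using B fin by simp
    moreover have D: "?D \<subseteq> Y" "finite ?D"
      using B(1) fin by auto
    ultimately have "card Y = card (Y - ?D) + (k - 1)"
      using card_mono[OF fin(1) D(1)] by (simp add: card_Diff_subset)
    \<comment> \<open>As \<open>sum w B\<close> is negative, the total rises by more than
      \<open>w x\<close>.\<close>
    moreover have "sum w (Y - ?D) = sum w Y - (sum w B - w x)"
      using sum_diff[OF fin(1) D(1), of w] B(3) fin(2) by (simp add: sum_diff1)
    moreover have "0 \<le> real r * w x"
      using wx by simp
    moreover have "real (Suc r) * w x = real r * w x + w x"
      by (simp add: algebra_simps)
    ultimately show ?thesis
      using Y B False by (intro exI[of _ "Y - ?D"]) auto
  qed
qed

lemma card_nonneg_sets_weak:
  fixes w :: "'a \<Rightarrow> real"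
  assumes "finite X" "X \<noteq> {}" "0 \<le> sum w X" "k \<ge> 1"
  shows "(card X - 1 - k * (k - 1)) choose (k - 1) \<le> card (nonneg_sets w k X)"
proof -
  obtain x where x: "x \<in> X" "\<And>i. i \<in> X \<Longrightarrow> w i \<le> w x"
    using finite_arg_max[OF assms(1,2)] by blast
  obtain Y where Y: "Y \<subseteq> X" "x \<in> Y" "card X \<le> card Y + k * (k - 1)"
    "real k * w x \<le> sum w Y \<or> star_nonneg w k Y x"
    using deletion_process[OF assms(1) x assms(3), of k k] by auto
  have fin: "finite Y"
    using Y(1) assms(1) by (rule finite_subset)
  have *: "(card Y - 1) choose (k - 1) \<le> card (nonneg_sets w k X)"
    if "star_nonneg w k Y x \<or> 0 < w x"
  proof (cases "star_nonneg w k Y x")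
    case True
    have "(card Y - 1) choose (k - 1) \<le> card (nonneg_sets w k Y)"
      using card_nonneg_sets_star[OF True fin Y(2) assms(4)] .
    also have "\<dots> \<le> card (nonneg_sets w k X)"
      using finite_nonneg_sets[OF assms(1)] nonneg_sets_mono[OF Y(1)] by (rule card_mono)
    finally show ?thesis .
  next
    case False
    then have "1 * ((card Y - 1) choose (k - 1)) \<le> card (nonneg_sets w k Y)"
      using that Y x by (intro card_nonneg_sets_average[where c = "w x"] fin assms) auto
    also have "\<dots> \<le> card (nonneg_sets w k X)"
      using finite_nonneg_sets[OF assms(1)] nonneg_sets_mono[OF Y(1)] by (rule card_mono)
    finally show ?thesis by simp
  qed
  show ?thesis
  \<comment> \<open>The maximum may be zero if the star in \<open>X\<close> is nonnegative, so that
    case is counted directly; otherwise \<open>max_pos\<close> makes \<open>*\<close>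
    applicable.\<close>
  proof (cases "star_nonneg w k X x")
    case True
    have "(card X - 1 - k * (k - 1)) choose (k - 1) \<le> (card X - 1) choose (k - 1)"
      by (rule binomial_right_mono) simp
    also have "\<dots> \<le> card (nonneg_sets w k X)"
      using card_nonneg_sets_star[OF True assms(1) x(1) assms(4)] .
    finally show ?thesis .
  next
    case False
    have "(card X - 1 - k * (k - 1)) choose (k - 1) \<le> (card Y - 1) choose (k - 1)"
      using Y(3) by (intro binomial_right_mono) simp
    also have "\<dots> \<le> card (nonneg_sets w k X)"
      using max_pos[OF assms(1) x assms(3) False] by (intro *) simp
    finally show ?thesis .
  qed
qed

section \<open>Binomial estimates\<close>

lemma binomial_le_diff:
  "M choose Suc j \<le> ((M - d) choose Suc j) + d * ((M - 1) choose j)"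
proof (induction d)
  case (Suc d)
  \<comment> \<open>One use of Pascal's rule; if \<open>M - d\<close> is zero, the left side
    vanishes.\<close>
  have "(M - d) choose Suc j \<le> ((M - Suc d) choose Suc j) + ((M - 1) choose j)"
  proof (cases "M - d")
    case (Suc m)
    then have "M - Suc d = m" "m \<le> M - 1" by auto
    then show ?thesis
      using Suc binomial_right_mono[of m "M - 1" j] by simp
  qed simp
  with Suc show ?case by simp
qed simp

text \<open>Lowering \<open>M\<close> by \<open>d\<close> loses at most
  \<open>d * ((M - 1) choose (j - 1))\<close>. By the absorption identity this is
  \<open>d * j / M\<close> times \<open>M choose j\<close>, hence at most half of it.\<close>

lemma binomial_le_twice:
  assumes "2 * d * j \<le> M"
  shows "M choose j \<le> 2 * ((M - d) choose j)"
proof (cases j)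
  case (Suc i)
  show ?thesis
  proof (cases "M = 0")
    case False
    have "2 * d * j * ((M - 1) choose i) \<le> M * ((M - 1) choose i)"
      using assms by (rule mult_right_mono) simp
    also have "\<dots> = j * (M choose j)"
      using Suc False Suc_times_binomial_eq[of "M - 1" i] by (simp add: mult.commute)
    finally have "j * (2 * d * ((M - 1) choose i)) \<le> j * (M choose j)"
      by (simp add: algebra_simps)
    then have "2 * d * ((M - 1) choose i) \<le> M choose j"
      using Suc by (simp only: mult_le_cancel1)
    then show ?thesis
      using binomial_le_diff[of M i d] Suc by simp
  qed (use Suc in simp)
qed simp

section \<open>Combining the two families of sets\<close>

theorem card_nonneg_sets_ge:
  fixes w :: "'a \<Rightarrow> real"
  assumes "finite X" "k \<ge> 1" "card X > 10 * k ^ 3" "0 \<le> sum w X"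
  shows "(card X - 1) choose (k - 1) \<le> card (nonneg_sets w k X)"
proof -
  have "X \<noteq> {}"
    using assms(3) by auto
  then obtain x where x: "x \<in> X" "\<And>i. i \<in> X \<Longrightarrow> w i \<le> w x"
    using finite_arg_max[OF assms(1)] by blast
  show ?thesis
  proof (cases "star_nonneg w k X x")
    case True
    then show ?thesis
      by (rule card_nonneg_sets_star[OF _ assms(1) x(1) assms(2)])
  next
    case False
    have pos: "0 < w x"
      using max_pos[OF assms(1) x assms(4) False] .
    \<comment> \<open>Total loss: \<open>2 * k * (k - 1)\<close> for the first round of deletions,
      \<open>k * (k - 1)\<close> for the second, and 1 for \<open>x\<close> itself.\<close>
    define d where "d = 1 + 3 * k * (k - 1)"
    obtain Y where Y: "Y \<subseteq> X" "x \<in> Y" "card X \<le> card Y + 2 * k * (k - 1)"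
      "Y = X \<or> w x \<le> sum w Y" "real (2 * k) * w x \<le> sum w Y \<or> star_nonneg w k Y x"
      using deletion_process[OF assms(1) x assms(4), of "2 * k" k] by blast
    have fin: "finite Y"
      using Y(1) assms(1) by (rule finite_subset)
    \<comment> \<open>The first bound keeps \<open>Y - {x}\<close> nonempty; the second is the
      hypothesis of \<open>binomial_le_twice\<close> with \<open>M = card X - 1\<close>.\<close>
    have small: "d + k \<le> 10 * k ^ 3" "2 * d * (k - 1) \<le> 10 * k ^ 3"
    proof -
      obtain l where l: "k = Suc l"
        using assms(2) by (cases k) auto
      show "d + k \<le> 10 * k ^ 3" "2 * d * (k - 1) \<le> 10 * k ^ 3"
        unfolding d_def l by (auto simp: power3_eq_cube algebra_simps)
    qed
    have "(card X - 1) choose (k - 1) \<le> 2 * ((card X - 1 - d) choose (k - 1))"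
      using small assms(3) by (intro binomial_le_twice) simp
    also have "\<dots> \<le> card (nonneg_sets w k Y)"
    proof (cases "star_nonneg w k Y x")
      case True
      let ?Z = "Y - {x}"
      \<comment> \<open>The star is nonnegative in \<open>Y\<close> but not in \<open>X\<close>, so
        \<open>Y\<close> differs from \<open>X\<close> and its total is at least
        \<open>w x\<close>.\<close>
      have Z: "0 \<le> sum w ?Z" "card X \<le> card ?Z + 2 * k * (k - 1) + 1"
        using Y True False fin by (auto simp: sum_diff1)
      have "?Z \<noteq> {}"
      proof
        assume "?Z = {}"
        with Z(2) have "card X \<le> d"
          by (simp only: d_def card.empty)
        with small assms(3) show False by simp
      qed
      then have "(card ?Z - 1 - k * (k - 1)) choose (k - 1) \<le> card (nonneg_sets w k ?Z)"
        using Z(1) fin assms(2) by (intro card_nonneg_sets_weak) auto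
      moreover have "(card X - 1 - d) choose (k - 1) \<le> (card ?Z - 1 - k * (k - 1)) choose (k - 1)"
        using Z(2) unfolding d_def by (intro binomial_right_mono) simp
      moreover have "(card Y - 1) choose (k - 1) \<le> card {A \<in> nonneg_sets w k Y. x \<in> A}"
        using card_nonneg_sets_through_star[OF True fin Y(2) assms(2)] .
      moreover have "(card X - 1 - d) choose (k - 1) \<le> (card Y - 1) choose (k - 1)"
        using Y(3) unfolding d_def by (intro binomial_right_mono) simp
      moreover have "card (nonneg_sets w k Y) =
          card {A \<in> nonneg_sets w k Y. x \<in> A} + card (nonneg_sets w k ?Z)"
      proof -
        have *: "nonneg_sets w k Y = {A \<in> nonneg_sets w k Y. x \<in> A} \<union> nonneg_sets w k ?Z"
          by (auto simp: nonneg_sets_def)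
        moreover have "{A \<in> nonneg_sets w k Y. x \<in> A} \<inter> nonneg_sets w k ?Z = {}"
          by (auto simp: nonneg_sets_def)
        ultimately show ?thesis
          using fin by (subst (1) * , intro card_Un_disjoint) (auto simp: finite_nonneg_sets)
      qed
      ultimately show ?thesis by linarith
    next
      case False
      have "2 * ((card X - 1 - d) choose (k - 1)) \<le> 2 * ((card Y - 1) choose (k - 1))"
        using Y(3) unfolding d_def by (intro mult_left_mono binomial_right_mono) simp_all
      also have "\<dots> \<le> card (nonneg_sets w k Y)"
        \<comment> \<open>All \<open>2 * k\<close> deletions took place, so averaging applies with
          \<open>r = 2\<close>.\<close>
        using Y False x pos by (intro card_nonneg_sets_average[where c = "w x"] fin assms) auto
      finally show ?thesis .
    qed
    also have "\<dots> \<le> card (nonneg_sets w k X)"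
      using finite_nonneg_sets[OF assms(1)] nonneg_sets_mono[OF Y(1)] by (rule card_mono)
    finally show ?thesis .
  qed
qed

theorem mainTheorem5:
  fixes k n :: nat and w :: "nat \<Rightarrow> real"
  assumes "k \<ge> 1"
    and "n > 10 * k ^ 3"
    and "(\<Sum>i = 1..n. w i) \<ge> 0"
  shows "card {A. A \<subseteq> {1..n} \<and> card A = k \<and> (\<Sum>i\<in>A. w i) \<ge> 0} \<ge> (n - 1) choose (k - 1)"
  using card_nonneg_sets_ge[of "{1..n}" k w] assms by (simp add: nonneg_sets_def)

end
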